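(* Fix $\eta\in\{i,j,k\}$. For any $n\times n$ quaternionic invertible matrix $G$, there exist an $n\times n$ quaternionic unitary matrix $U$, an $n\times n$ quaternionic orthogonal matrix $O$, i.e. $O\in\mathbb{H}^{n\times n}$ with $O^{D_\eta}O=I_n$, and a unique (up to permutation of the diagonal) $n\times n$ positive diagonal matrix $\Sigma$ such that $$G=U\Sigma O.$$
   Context: $\mathbb{H}$ denotes the real quaternions with imaginary units $i,j,k$. For $M\in\mathbb{H}^{n\times n}$, $M^D$ is the quaternionic conjugate transpose, $(M^D)_{ab}=\overline{M_{ba}}$, and the $\eta$-conjugate transpose is $M^{D_\eta}=\eta^{-1}M^D\eta=-\eta M^D\eta$. $U$ is quaternionic unitary if $U^DU=I_n$. A positive diagonal matrix is a real diagonal matrix with positive diagonal entries. *)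

theory Defs
  imports "HOL-Analysis.Analysis" "HOL-Combinatorics.Permutations"
begin

section \<open>Quaternions\<close>

text \<open>\<open>Quat a b c d\<close> stands for $a + bi + cj + dk$.\<close>

datatype quat = Quat (q0: real) (q1: real) (q2: real) (q3: real)

lemma quat_eq_iff: "x = y \<longleftrightarrow> q0 x = q0 y \<and> q1 x = q1 y \<and> q2 x = q2 y \<and> q3 x = q3 y"
  by (cases x; cases y) simp

definition qcnj :: "quat \<Rightarrow> quat"
  where "qcnj x = Quat (q0 x) (- q1 x) (- q2 x) (- q3 x)"

definition qi :: quat where "qi = Quat 0 1 0 0"
definition qj :: quat where "qj = Quat 0 0 1 0"
definition qk :: quat where "qk = Quat 0 0 0 1"

lemma qcnj_sel [simp]:
  "q0 (qcnj x) = q0 x" "q1 (qcnj x) = - q1 x" "q2 (qcnj x) = - q2 x" "q3 (qcnj x) = - q3 x"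
  by (simp_all add: qcnj_def)

lemma units_sel [simp]:
  "q0 qi = 0" "q1 qi = 1" "q2 qi = 0" "q3 qi = 0"
  "q0 qj = 0" "q1 qj = 0" "q2 qj = 1" "q3 qj = 0"
  "q0 qk = 0" "q1 qk = 0" "q2 qk = 0" "q3 qk = 1"
  by (simp_all add: qi_def qj_def qk_def)

instantiation quat :: real_vector
begin

definition "0 = Quat 0 0 0 0"
definition "x + y = Quat (q0 x + q0 y) (q1 x + q1 y) (q2 x + q2 y) (q3 x + q3 y)"
definition "- x = Quat (- q0 x) (- q1 x) (- q2 x) (- q3 x)"
definition "x - y = Quat (q0 x - q0 y) (q1 x - q1 y) (q2 x - q2 y) (q3 x - q3 y)"
definition "r *\<^sub>R x = Quat (r * q0 x) (r * q1 x) (r * q2 x) (r * q3 x)"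

instance
  by standard
    (simp_all add: quat_eq_iff zero_quat_def plus_quat_def uminus_quat_def minus_quat_def
      scaleR_quat_def algebra_simps)

end

lemma quat_linear_sel [simp]:
  "q0 0 = 0" "q1 0 = 0" "q2 0 = 0" "q3 0 = 0"
  "q0 (x + y) = q0 x + q0 y" "q1 (x + y) = q1 x + q1 y"
  "q2 (x + y) = q2 x + q2 y" "q3 (x + y) = q3 x + q3 y"
  "q0 (- x) = - q0 x" "q1 (- x) = - q1 x" "q2 (- x) = - q2 x" "q3 (- x) = - q3 x"
  "q0 (x - y) = q0 x - q0 y" "q1 (x - y) = q1 x - q1 y"
  "q2 (x - y) = q2 x - q2 y" "q3 (x - y) = q3 x - q3 y"
  "q0 (r *\<^sub>R x) = r * q0 x" "q1 (r *\<^sub>R x) = r * q1 x"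
  "q2 (r *\<^sub>R x) = r * q2 x" "q3 (r *\<^sub>R x) = r * q3 x"
  by (simp_all add: zero_quat_def plus_quat_def uminus_quat_def minus_quat_def scaleR_quat_def)

instantiation quat :: real_algebra_1
begin

definition "1 = Quat 1 0 0 0"

definition "x * y = Quat
  (q0 x * q0 y - q1 x * q1 y - q2 x * q2 y - q3 x * q3 y)
  (q0 x * q1 y + q1 x * q0 y + q2 x * q3 y - q3 x * q2 y)
  (q0 x * q2 y - q1 x * q3 y + q2 x * q0 y + q3 x * q1 y)
  (q0 x * q3 y + q1 x * q2 y - q2 x * q1 y + q3 x * q0 y)"

instance
  by standard (simp_all add: quat_eq_iff one_quat_def times_quat_def algebra_simps)

end

lemma quat_mult_sel [simp]:
  "q0 1 = 1" "q1 1 = 0" "q2 1 = 0" "q3 1 = 0"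
  "q0 (x * y) = q0 x * q0 y - q1 x * q1 y - q2 x * q2 y - q3 x * q3 y"
  "q1 (x * y) = q0 x * q1 y + q1 x * q0 y + q2 x * q3 y - q3 x * q2 y"
  "q2 (x * y) = q0 x * q2 y - q1 x * q3 y + q2 x * q0 y + q3 x * q1 y"
  "q3 (x * y) = q0 x * q3 y + q1 x * q2 y - q2 x * q1 y + q3 x * q0 y"
  by (simp_all add: one_quat_def times_quat_def)

definition qnorm2 :: "quat \<Rightarrow> real"
  where "qnorm2 x = (q0 x)\<^sup>2 + (q1 x)\<^sup>2 + (q2 x)\<^sup>2 + (q3 x)\<^sup>2"

lemma qnorm2_eq_0_iff: "qnorm2 x = 0 \<longleftrightarrow> x = 0"
  unfolding qnorm2_def quat_eq_iff
  by (simp add: add_nonneg_eq_0_iff)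

lemma mult_qcnj: "x * qcnj x = qnorm2 x *\<^sub>R 1" and qcnj_mult: "qcnj x * x = qnorm2 x *\<^sub>R 1"
  by (simp_all add: quat_eq_iff qnorm2_def power2_eq_square)

instantiation quat :: real_div_algebra
begin

definition "inverse x = inverse (qnorm2 x) *\<^sub>R qcnj x"
definition "x div y = x * inverse (y::quat)"

instance
proof
  fix x y :: quat
  show "inverse x * x = 1" "x * inverse x = 1" if "x \<noteq> 0"
    using that qnorm2_eq_0_iff[of x] by (simp_all add: inverse_quat_def mult_qcnj qcnj_mult)
  show "x div y = x * inverse y" by (rule divide_quat_def)
  show "inverse (0::quat) = 0" by (simp add: inverse_quat_def quat_eq_iff)
qed

end

lemma quat_unit_relations:
  "qi * qi = -1" "qj * qj = -1" "qk * qk = -1"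
  "qi * qj = qk" "qj * qk = qi" "qk * qi = qj"
  "qj * qi = - qk" "qk * qj = - qi" "qi * qk = - qj"
  by (simp_all add: quat_eq_iff)

lemma inverse_units: "\<eta> \<in> {qi, qj, qk} \<Longrightarrow> inverse \<eta> = - \<eta>"
  by (auto simp: inverse_quat_def quat_eq_iff qnorm2_def)

section \<open>Quaternionic matrices\<close>

definition conj_transpose :: "quat ^ 'n ^ 'm \<Rightarrow> quat ^ 'm ^ 'n"
  where "conj_transpose M = (\<chi> a b. qcnj (M $ b $ a))"

text \<open>Multiplying a matrix by the scalar \<open>\<eta>\<close> on either side acts entrywise, so the entries of
  $\eta^{-1} M^D \eta$ are the following.\<close>

definition eta_conj_transpose :: "quat \<Rightarrow> quat ^ 'n ^ 'm \<Rightarrow> quat ^ 'm ^ 'n"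
  where "eta_conj_transpose \<eta> M = (\<chi> a b. inverse \<eta> * (conj_transpose M $ a $ b) * \<eta>)"

lemma eta_conj_transpose_units:
  assumes "\<eta> \<in> {qi, qj, qk}"
  shows "eta_conj_transpose \<eta> M = (\<chi> a b. - \<eta> * (conj_transpose M $ a $ b) * \<eta>)"
  using inverse_units[OF assms] by (simp add: eta_conj_transpose_def)

definition quat_unitary :: "quat ^ 'n ^ 'n \<Rightarrow> bool"
  where "quat_unitary U \<longleftrightarrow> conj_transpose U ** U = mat 1"

definition quat_orthogonal :: "quat \<Rightarrow> quat ^ 'n ^ 'n \<Rightarrow> bool"
  where "quat_orthogonal \<eta> Q \<longleftrightarrow> eta_conj_transpose \<eta> Q ** Q = mat 1"

definition positive_diagonal :: "quat ^ 'n ^ 'n \<Rightarrow> bool"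
  where "positive_diagonal S \<longleftrightarrow>
    (\<forall>a b. a \<noteq> b \<longrightarrow> S $ a $ b = 0) \<and> (\<forall>a. \<exists>r>0. S $ a $ a = of_real r)"

end

theory Submission
  imports Defs
begin

text \<open>A factorisation $G = U \Sigma O$ with $U$ unitary has $O$ orthogonal if and only if
  $U^D A U = \eta\,\Sigma^{-2}$ for the skew-Hermitian matrix $A = G^{-D} \eta\, G^{-1}$. Existence is
  therefore the spectral theorem for $A$: over the compact unitary group, the real part of
  the trace of $-i\, V^D A V$ with distinct positive weights is maximal only where $V^D A V$ is diagonal, and each
  purely imaginary diagonal entry is then conjugated by a unit quaternion to a positive multiple of
  $\eta$. For uniqueness, two such diagonal forms are intertwined by a unitary matrix.\<close>

section \<open>The quaternions as a Euclidean space\<close>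

text \<open>The inner product is the real part of \<open>qcnj x * y\<close>, so
  \<open>inner qi z\<close> is the real part of \<open>- qi * z\<close>, as in the trace functional
  maximised below.\<close>

instantiation quat :: real_inner
begin

definition "inner x y = q0 x * q0 y + q1 x * q1 y + q2 x * q2 y + q3 x * q3 (y::quat)"
definition "norm x = sqrt (qnorm2 x)"
definition "sgn x = x /\<^sub>R norm (x::quat)"
definition "dist x y = norm (x - y :: quat)"
definition [code del]:
  "(uniformity :: (quat \<times> quat) filter) = (INF e\<in>{0<..}. principal {(x, y). dist x y < e})"
definition [code del]:
  "open (S :: quat set) \<longleftrightarrow> (\<forall>x\<in>S. \<forall>\<^sub>F (x', y) in uniformity. x' = x \<longrightarrow> y \<in> S)"

instance
proof
  fix x y z :: quat and r :: real and S :: "quat set"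
  show "inner x x = 0 \<longleftrightarrow> x = 0"
    using qnorm2_eq_0_iff[of x] by (simp add: inner_quat_def qnorm2_def power2_eq_square)
qed (simp_all add: inner_quat_def norm_quat_def qnorm2_def sgn_quat_def dist_quat_def
      uniformity_quat_def open_quat_def algebra_simps power2_eq_square)

end

lemma norm_quat_sq: "(norm x)\<^sup>2 = qnorm2 (x::quat)"
  by (simp add: norm_quat_def qnorm2_def)

instance quat :: real_normed_div_algebra
proof
  fix x y :: quat
  \<comment> \<open>Once squared, multiplicativity of the norm is Euler's four-square
    identity.\<close>
  have "(norm (x * y))\<^sup>2 = (norm x * norm y)\<^sup>2"
    unfolding power_mult_distrib norm_quat_sq by (simp add: qnorm2_def) algebra
  then show "norm (x * y) = norm x * norm y"
    by (simp add: power2_eq_iff_nonneg)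
qed

text \<open>Finite dimension over the reals makes quaternionic matrices a Heine-Borel space, as the
  compactness argument requires.\<close>

instantiation quat :: euclidean_space
begin

definition "Basis = {1, qi, qj, qk}"

instance
proof
  fix x :: quat
  show "(\<forall>u\<in>Basis. inner x u = 0) \<longleftrightarrow> x = 0"
    unfolding Basis_quat_def quat_eq_iff[of x 0] by (simp add: inner_quat_def)
qed (auto simp: Basis_quat_def inner_quat_def quat_eq_iff)

end

lemma qcnj_simps [simp]:
  "qcnj 0 = 0" "qcnj 1 = 1" "qcnj (of_real r) = of_real r" "qcnj (qcnj x) = x"
  "qcnj (x + y) = qcnj x + qcnj y" "qcnj (x - y) = qcnj x - qcnj y" "qcnj (- x) = - qcnj x"
  "qcnj (x * y) = qcnj y * qcnj x" "qcnj (r *\<^sub>R x) = r *\<^sub>R qcnj x" "norm (qcnj x) = norm x"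
  by (simp_all add: quat_eq_iff of_real_def norm_quat_def qnorm2_def)

lemma qcnj_sum: "qcnj (sum f S) = (\<Sum>a\<in>S. qcnj (f a))"
  by (induction S rule: infinite_finite_induct) simp_all

lemma continuous_on_qcnj [continuous_intros]:
  "continuous_on S f \<Longrightarrow> continuous_on S (\<lambda>x. qcnj (f x))"
proof -
  have "bounded_linear qcnj"
    by (rule bounded_linear_intro[where K = 1]) simp_all
  then show "continuous_on S f \<Longrightarrow> continuous_on S (\<lambda>x. qcnj (f x))"
    by (rule bounded_linear.continuous_on)
qed

section \<open>Conjugate transposes, diagonal matrices and unitary matrices\<close>

lemma conj_transpose_nth [simp]: "conj_transpose M $ a $ b = qcnj (M $ b $ a)"
  by (simp add: conj_transpose_def)

lemma conj_transpose_conj_transpose [simp]: "conj_transpose (conj_transpose M) = M"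
  by (simp add: vec_eq_iff)

lemma conj_transpose_mult: "conj_transpose (M ** N) = conj_transpose N ** conj_transpose M"
  by (simp add: vec_eq_iff matrix_matrix_mult_def qcnj_sum)

lemma conj_transpose_mat_1 [simp]: "conj_transpose (mat 1) = mat 1"
  by (auto simp: vec_eq_iff mat_def)

definition diag_mat :: "('n \<Rightarrow> 'a::zero) \<Rightarrow> 'a ^ 'n ^ 'n"
  where "diag_mat d = (\<chi> a b. if a = b then d a else 0)"

lemma diag_mat_nth: "diag_mat d $ a $ b = (if a = b then d a else 0)"
  by (simp add: diag_mat_def)

text \<open>Since \<open>mat \<eta>\<close> need not commute with other quaternionic matrices, it is
  treated as a diagonal matrix; the two entry rules below keep track of the side.\<close>

lemma mat_eq_diag_mat: "mat x = diag_mat (\<lambda>_. x)"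
  by (simp add: mat_def diag_mat_def)

lemma diag_mat_mult_nth: "(diag_mat d ** M) $ a $ b = d a * M $ a $ b"
  for d :: "_ \<Rightarrow> _ :: semiring_1"
  by (simp add: matrix_matrix_mult_def diag_mat_nth if_distrib[of "\<lambda>x. x * _"] cong: if_cong)

lemma mult_diag_mat_nth: "(M ** diag_mat d) $ a $ b = M $ a $ b * d b"
  for d :: "_ \<Rightarrow> _ :: semiring_1"
  by (simp add: matrix_matrix_mult_def diag_mat_nth if_distrib[of "\<lambda>x. _ * x"] cong: if_cong)

lemma diag_mat_mult: "diag_mat d ** diag_mat e = diag_mat (\<lambda>a. d a * e a)"
  for d e :: "_ \<Rightarrow> _ :: semiring_1"
  by (simp add: vec_eq_iff diag_mat_mult_nth) (simp add: diag_mat_nth)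

lemma conj_transpose_diag_mat: "conj_transpose (diag_mat d) = diag_mat (\<lambda>a. qcnj (d a))"
  by (auto simp: vec_eq_iff diag_mat_nth)

text \<open>With products nested to the right by \<open>matrix_mul_assoc[symmetric]\<close>, this
  rewrite deletes an inverse pair in front of any tail.\<close>

lemma matrix_mul_cancel: "A ** B = mat 1 \<Longrightarrow> A ** (B ** X) = X"
  for A B :: "'a::semiring_1 ^ 'n ^ 'n"
  by (simp add: matrix_mul_assoc)

text \<open>For a square quaternionic matrix the second condition follows from the first, but only by a
  dimension count over a skew field; carrying both avoids it.\<close>

definition two_sided_unitary :: "quat ^ 'n ^ 'n \<Rightarrow> bool"
  where "two_sided_unitary U \<longleftrightarrow> conj_transpose U ** U = mat 1 \<and> U ** conj_transpose U = mat 1"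

lemma two_sided_unitary_mult:
  assumes "two_sided_unitary U" "two_sided_unitary V"
  shows "two_sided_unitary (U ** V)"
  using assms unfolding two_sided_unitary_def conj_transpose_mult
  by (simp add: matrix_mul_assoc[symmetric] matrix_mul_cancel)

lemma two_sided_unitary_conj_transpose:
  "two_sided_unitary U \<Longrightarrow> two_sided_unitary (conj_transpose U)"
  by (simp add: two_sided_unitary_def)

lemma two_sided_unitary_diag_mat:
  assumes "\<And>a. norm (d a) = 1"
  shows "two_sided_unitary (diag_mat d)"
proof -
  have "qnorm2 (d a) = 1" for a
    using assms norm_quat_sq[of "d a"] by simp
  then show ?thesis
    by (simp add: two_sided_unitary_def conj_transpose_diag_mat diag_mat_mult mat_eq_diag_mat
        mult_qcnj qcnj_mult)
qed

text \<open>The diagonal of \<open>conj_transpose U ** U\<close> holds the squared lengths of the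
  columns. This bounds all entries and, with the row version, makes the squared norms of the entries
  doubly stochastic.\<close>

lemma two_sided_unitary_column: "two_sided_unitary U \<Longrightarrow> (\<Sum>a\<in>UNIV. (norm (U $ a $ b))\<^sup>2) = 1"
proof -
  assume "two_sided_unitary U"
  then have "(conj_transpose U ** U) $ b $ b = 1"
    by (simp add: two_sided_unitary_def mat_def)
  then have "of_real (\<Sum>a\<in>UNIV. (norm (U $ a $ b))\<^sup>2) = (1 :: quat)"
    by (simp add: matrix_matrix_mult_def qcnj_mult norm_quat_sq of_real_def scaleR_left.sum)
  then show ?thesis
    by (metis of_real_eq_1_iff)
qed

lemma two_sided_unitary_row: "two_sided_unitary U \<Longrightarrow> (\<Sum>b\<in>UNIV. (norm (U $ a $ b))\<^sup>2) = 1"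
  using two_sided_unitary_column[OF two_sided_unitary_conj_transpose, of U a] by simp

text \<open>Unit columns bound every entry by one, and the defining equations are closed
  conditions.\<close>

lemma compact_two_sided_unitary: "compact {U :: quat ^ 'n ^ 'n. two_sided_unitary U}"
proof -
  have "norm U \<le> (\<Sum>a\<in>(UNIV::'n set). \<Sum>b\<in>(UNIV::'n set). 1)"
    if "two_sided_unitary U" for U :: "quat ^ 'n ^ 'n"
  proof -
    have entry: "norm (U $ a $ b) \<le> 1" for a b
    proof -
      have "(norm (U $ a $ b))\<^sup>2 \<le> (\<Sum>c\<in>UNIV. (norm (U $ c $ b))\<^sup>2)"
        by (rule member_le_sum) simp_all
      then show ?thesis
        using two_sided_unitary_column[OF that, of b] by (simp add: power_le_one_iff)
    qed
    have "norm U \<le> (\<Sum>a\<in>UNIV. norm (U $ a))"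
      unfolding norm_vec_def[of U] by (rule L2_set_le_sum) simp
    also have "\<dots> \<le> (\<Sum>a\<in>UNIV. \<Sum>b\<in>UNIV. norm (U $ a $ b))"
      unfolding norm_vec_def[of "U $ _"] by (intro sum_mono L2_set_le_sum) simp
    also have "\<dots> \<le> (\<Sum>a\<in>(UNIV::'n set). \<Sum>b\<in>(UNIV::'n set). 1)"
      by (intro sum_mono entry)
    finally show ?thesis .
  qed
  then have "bounded {U :: quat ^ 'n ^ 'n. two_sided_unitary U}"
    unfolding bounded_iff by blast
  moreover have "closed {U :: quat ^ 'n ^ 'n. two_sided_unitary U}"
    unfolding two_sided_unitary_def vec_eq_iff matrix_matrix_mult_def
    by (simp, intro closed_Collect_conj closed_Collect_all closed_Collect_eq continuous_intros)
  ultimately show ?thesis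
    by (simp add: compact_eq_bounded_closed)
qed

section \<open>Plane rotations\<close>

text \<open>A quaternionic Givens rotation: for distinct \<open>a\<close>, \<open>b\<close> the
  block on these coordinates has rows \<open>(c, - qcnj w)\<close> and \<open>(w, c)\<close>. The
  real \<open>c\<close> commutes with \<open>w\<close>, so the two columns are orthogonal;
  \<open>w\<close> carries the sine together with a phase.\<close>

definition plane_rot :: "'n \<Rightarrow> 'n \<Rightarrow> real \<Rightarrow> quat \<Rightarrow> quat ^ 'n ^ 'n"
  where "plane_rot a b c w = (\<chi> i j.
    if j = a then (if i = a then of_real c else if i = b then w else 0)
    else if j = b then (if i = a then - qcnj w else if i = b then of_real c else 0)
    else if i = j then 1 else 0)"

lemma conj_transpose_plane_rot: "a \<noteq> b \<Longrightarrow> conj_transpose (plane_rot a b c w) = plane_rot a b c (- w)"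
  by (auto simp: vec_eq_iff plane_rot_def)

lemma sum_two_points:
  fixes f :: "'n::finite \<Rightarrow> 'a::comm_monoid_add"
  assumes "a \<noteq> b" "\<And>x. x \<noteq> a \<Longrightarrow> x \<noteq> b \<Longrightarrow> f x = 0"
  shows "sum f UNIV = f a + f b"
proof -
  have "sum f UNIV = sum f {a, b}"
    by (rule sum.mono_neutral_right) (use assms in auto)
  then show ?thesis using assms(1) by simp
qed

lemma mult_plane_rot_nth:
  assumes "a \<noteq> b"
  shows "(M ** plane_rot a b c w) $ i $ j =
    (if j = a then M $ i $ a * of_real c + M $ i $ b * w
     else if j = b then M $ i $ b * of_real c - M $ i $ a * qcnj w else M $ i $ j)"
proof -
  have "(M ** plane_rot a b c w) $ i $ j = M $ i $ a * plane_rot a b c w $ a $ j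
      + M $ i $ b * plane_rot a b c w $ b $ j" if "j = a \<or> j = b"
    unfolding matrix_matrix_mult_def using that
    by (simp, intro sum_two_points) (use assms in \<open>auto simp: plane_rot_def\<close>)
  moreover have "(M ** plane_rot a b c w) $ i $ j = M $ i $ j" if "j \<noteq> a" "j \<noteq> b"
    using that by (simp add: matrix_matrix_mult_def plane_rot_def
        if_distrib[of "\<lambda>x. _ * x"] cong: if_cong)
  ultimately show ?thesis
    using assms by (auto simp: plane_rot_def)
qed

lemma plane_rot_mult_nth:
  assumes "a \<noteq> b"
  shows "(conj_transpose (plane_rot a b c w) ** M) $ i $ j =
    (if i = a then of_real c * M $ a $ j + qcnj w * M $ b $ j
     else if i = b then of_real c * M $ b $ j - w * M $ a $ j else M $ i $ j)"
proof -
  have "(conj_transpose (plane_rot a b c w) ** M) $ i $ j =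
      qcnj ((conj_transpose M ** plane_rot a b c w) $ j $ i)"
    by (simp flip: conj_transpose_nth add: conj_transpose_mult)
  then show ?thesis
    using assms by (simp add: mult_plane_rot_nth)
qed

lemma two_sided_unitary_plane_rot:
  assumes "a \<noteq> b" "c\<^sup>2 + qnorm2 w = 1"
  shows "two_sided_unitary (plane_rot a b c w)"
proof -
  \<comment> \<open>Proved for every \<open>w\<close>, because the conjugate transpose is the
    rotation with \<open>- w\<close>: the instance at \<open>- w\<close> is the identity for the
    product in the other order.\<close>
  have "conj_transpose (plane_rot a b c w) ** plane_rot a b c w = mat 1"
    if "c\<^sup>2 + qnorm2 w = 1" for w :: quat
    using assms(1) that
    by (auto simp: vec_eq_iff plane_rot_mult_nth)
      (auto simp: plane_rot_def mat_def quat_eq_iff of_real_def qnorm2_def power2_eq_square algebra_simps)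
  from this[of w] this[of "- w"] show ?thesis
    using assms by (simp add: two_sided_unitary_def flip: conj_transpose_plane_rot)
      (simp add: conj_transpose_plane_rot qnorm2_def)
qed

section \<open>Diagonalisation of skew-Hermitian matrices\<close>

lemma quadratic_nonpos_imp_linear_zero:
  fixes \<beta> \<gamma> :: real
  assumes "\<And>t. t * \<beta> + t\<^sup>2 * \<gamma> \<le> 0"
  shows "\<beta> = 0"
proof (rule ccontr)
  assume "\<beta> \<noteq> 0"
  \<comment> \<open>At \<open>t = e * \<beta>\<close> the quadratic equals
    \<open>e * \<beta>\<^sup>2 * (1 + e * \<gamma>)\<close>; this \<open>e\<close> is small enough
    to keep the last factor positive.\<close>
  define e where "e = 1 / (\<bar>\<gamma>\<bar> + 1)"
  have e: "e > 0" "e * (\<bar>\<gamma>\<bar> + 1) = 1"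
    by (simp_all add: e_def)
  have "1 + e * \<gamma> > 0"
  proof -
    have "e * \<gamma> \<ge> e * (- \<bar>\<gamma>\<bar>)"
      using e(1) by (intro mult_left_mono) auto
    then show ?thesis using e by (simp add: algebra_simps)
  qed
  then have "e * \<beta>\<^sup>2 * (1 + e * \<gamma>) > 0"
    using e \<open>\<beta> \<noteq> 0\<close> by simp
  moreover have "e * \<beta>\<^sup>2 * (1 + e * \<gamma>) = (e * \<beta>) * \<beta> + (e * \<beta>)\<^sup>2 * \<gamma>"
    by (simp add: power2_eq_square algebra_simps)
  ultimately show False
    using assms[of "e * \<beta>"] by simp
qed

text \<open>The value \<alpha> is taken at angle zero, so the assumption is maximality there, and
  \<beta> is the derivative in the angle.\<close>

lemma trig_max_imp_linear_zero:
  fixes \<alpha> \<beta> \<gamma> :: real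
  assumes "\<And>c s. c\<^sup>2 + s\<^sup>2 = 1 \<Longrightarrow> c\<^sup>2 * \<alpha> + c * s * \<beta> + s\<^sup>2 * \<gamma> \<le> \<alpha>"
  shows "\<beta> = 0"
proof (rule quadratic_nonpos_imp_linear_zero)
  fix t :: real
  \<comment> \<open>Parametrises the circle by the tangent: \<open>s = t * c\<close>. Writing
    \<alpha> as \<open>c\<^sup>2 * (1 + t\<^sup>2) * \<alpha>\<close> then lets the positive factor
    \<open>c\<^sup>2\<close> be divided out.\<close>
  define c where "c = 1 / sqrt (1 + t\<^sup>2)"
  have c2: "c\<^sup>2 * (1 + t\<^sup>2) = 1"
    by (simp add: c_def power_divide add_pos_nonneg add_nonneg_eq_0_iff)
  then have "c\<^sup>2 * \<alpha> + c * (t * c) * \<beta> + (t * c)\<^sup>2 * \<gamma> \<le> \<alpha>"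
    by (intro assms) (simp add: power_mult_distrib algebra_simps)
  moreover have "\<alpha> = c\<^sup>2 * (1 + t\<^sup>2) * \<alpha>"
    using c2 by simp
  ultimately have "c\<^sup>2 * (t * \<beta> + t\<^sup>2 * (\<gamma> - \<alpha>)) \<le> 0"
    by (simp add: power2_eq_square algebra_simps)
  moreover have "c\<^sup>2 > 0"
    using c2 by (metis mult_zero_left zero_less_power2 zero_neq_one zero_eq_power2)
  ultimately show "t * \<beta> + t\<^sup>2 * (\<gamma> - \<alpha>) \<le> 0"
    by (simp add: mult_le_0_iff)
qed

text \<open>Stated for arbitrary \<open>V\<close>, as it serves both for unitary changes of basis
  and for the congruence by the inverse of \<open>G\<close>.\<close>

lemma skew_conjugate:
  assumes "conj_transpose A = - A"
  shows "conj_transpose (conj_transpose V ** A ** V) = - (conj_transpose V ** A ** V)"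
proof -
  have "- (conj_transpose V ** A ** V) = conj_transpose V ** (- A) ** V"
    by (simp add: vec_eq_iff matrix_matrix_mult_def sum_negf)
  then show ?thesis
    by (simp add: conj_transpose_mult assms matrix_mul_assoc)
qed

text \<open>The first-order condition at a maximum of the weighted trace: rotating in the \<open>(a, b)\<close> plane by
  an angle with quaternionic phase \<open>u\<close>, for each of the four basis units \<open>u\<close>, gives
  $w_a\,\eta B_{ab} = w_b\,B_{ab}\,\eta$, and taking norms forces $B_{ab} = 0$.\<close>

lemma weighted_trace_max_off_diagonal:
  fixes B :: "quat ^ 'n ^ 'n" and w :: "'n \<Rightarrow> real"
  assumes \<eta>: "\<eta> \<in> {qi, qj, qk}" and skew: "conj_transpose B = - B" and "a \<noteq> b"
    and w: "w a > 0" "w b > 0" "w a \<noteq> w b"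
    and max: "\<And>R. two_sided_unitary R \<Longrightarrow>
      (\<Sum>i\<in>UNIV. w i * inner \<eta> ((conj_transpose R ** B ** R) $ i $ i))
        \<le> (\<Sum>i\<in>UNIV. w i * inner \<eta> (B $ i $ i))"
  shows "B $ a $ b = 0"
proof -
  have Bba: "B $ b $ a = - qcnj (B $ a $ b)"
    using arg_cong[OF skew, of "\<lambda>M. M $ b $ a"] by simp
  have phase: "w a * inner \<eta> (B $ a $ b * u + qcnj u * B $ b $ a)
      - w b * inner \<eta> (u * B $ a $ b + B $ b $ a * qcnj u) = 0" (is "?\<beta> = 0")
    if "qnorm2 u = 1" for u
  proof (rule trig_max_imp_linear_zero)
    fix c s :: real
    assume cs: "c\<^sup>2 + s\<^sup>2 = 1"
    let ?R = "plane_rot a b c (s *\<^sub>R u)"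
    let ?B' = "conj_transpose ?R ** B ** ?R"
    let ?\<alpha> = "w a * inner \<eta> (B $ a $ a) + w b * inner \<eta> (B $ b $ b)"
    let ?\<gamma> = "w a * inner \<eta> (qcnj u * B $ b $ b * u) + w b * inner \<eta> (u * B $ a $ a * qcnj u)"
    have "qnorm2 (s *\<^sub>R u) = s\<^sup>2"
      using that by (simp flip: norm_quat_sq add: power_mult_distrib)
    then have R: "two_sided_unitary ?R"
      using \<open>a \<noteq> b\<close> cs by (simp add: two_sided_unitary_plane_rot)
    have diag: "?B' $ i $ i = B $ i $ i" if "i \<noteq> a" "i \<noteq> b" for i
      using that \<open>a \<noteq> b\<close> by (simp add: mult_plane_rot_nth plane_rot_mult_nth)
    have aa: "?B' $ a $ a = c\<^sup>2 *\<^sub>R B $ a $ a + (c * s) *\<^sub>R (B $ a $ b * u + qcnj u * B $ b $ a)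
        + s\<^sup>2 *\<^sub>R (qcnj u * B $ b $ b * u)"
      using \<open>a \<noteq> b\<close> by (simp add: mult_plane_rot_nth plane_rot_mult_nth of_real_def
          power2_eq_square algebra_simps)
    have bb: "?B' $ b $ b = c\<^sup>2 *\<^sub>R B $ b $ b - (c * s) *\<^sub>R (u * B $ a $ b + B $ b $ a * qcnj u)
        + s\<^sup>2 *\<^sub>R (u * B $ a $ a * qcnj u)"
      using \<open>a \<noteq> b\<close> by (simp add: mult_plane_rot_nth plane_rot_mult_nth of_real_def
          power2_eq_square algebra_simps)
    \<comment> \<open>The rotation changes only the diagonal entries at \<open>a\<close> and
      \<open>b\<close>, so the difference of the weighted traces collapses to two terms.\<close>
    have "0 \<le> (\<Sum>i\<in>UNIV. w i * inner \<eta> (B $ i $ i) - w i * inner \<eta> (?B' $ i $ i))"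
      using max[OF R] by (simp add: sum_subtractf)
    also have "\<dots> = (w a * inner \<eta> (B $ a $ a) - w a * inner \<eta> (?B' $ a $ a))
        + (w b * inner \<eta> (B $ b $ b) - w b * inner \<eta> (?B' $ b $ b))"
      by (rule sum_two_points) (use \<open>a \<noteq> b\<close> diag in simp_all)
    finally show "c\<^sup>2 * ?\<alpha> + c * s * ?\<beta> + s\<^sup>2 * ?\<gamma> \<le> ?\<alpha>"
      unfolding aa bb by (simp add: inner_add_right inner_diff_right algebra_simps)
  qed
  \<comment> \<open>In coordinates, the components of \<open>B $ a $ b\<close> commuting with \<eta>
    carry the factor \<open>w a - w b\<close>, nonzero by distinctness; the anticommuting ones carry
    \<open>w a + w b\<close>, up to sign, nonzero by positivity.\<close>
  have nonzero: "w a * (2 * x) + w b * (2 * x) = 0 \<longleftrightarrow> x = 0" for x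
    using w(1,2) by (simp flip: distrib_right)
  show ?thesis
    using phase[of 1] phase[of qi] phase[of qj] phase[of qk] \<eta> w(3) unfolding Bba
    by (auto simp: nonzero qnorm2_def inner_quat_def quat_eq_iff algebra_simps)
qed

lemma skew_unitarily_diagonal:
  fixes A :: "quat ^ 'n ^ 'n"
  assumes skew: "conj_transpose A = - A"
  obtains V d where "two_sided_unitary V" "conj_transpose V ** A ** V = diag_mat d"
proof -
  obtain f :: "'n \<Rightarrow> nat" where "inj f"
    using finite_imp_inj_to_nat_seg[of "UNIV :: 'n set"] by auto
  \<comment> \<open>The injection makes the weights distinct, and \<open>Suc\<close> makes them
    positive.\<close>
  define w where "w a = real (Suc (f a))" for a
  define F where "F V = (\<Sum>i\<in>UNIV. w i * inner qi ((conj_transpose V ** A ** V) $ i $ i))" for V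
  have "continuous_on {V. two_sided_unitary V} F"
    unfolding F_def matrix_matrix_mult_def by (simp, intro continuous_intros)
  moreover have "mat 1 \<in> {V :: quat ^ 'n ^ 'n. two_sided_unitary V}"
    by (simp add: two_sided_unitary_def)
  ultimately obtain V where V: "two_sided_unitary V"
    and max: "\<And>V'. two_sided_unitary V' \<Longrightarrow> F V' \<le> F V"
    using continuous_attains_sup[OF compact_two_sided_unitary] by blast
  let ?B = "conj_transpose V ** A ** V"
  have "?B $ a $ b = 0" if "a \<noteq> b" for a b
  proof (rule weighted_trace_max_off_diagonal[of qi _ _ _ w])
    show "w a \<noteq> w b"
      using \<open>inj f\<close> that by (auto simp: w_def dest: injD)
    \<comment> \<open>Maximality of \<open>V\<close> against the competitor \<open>V ** R\<close> is
      maximality of the identity for the conjugated matrix.\<close>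
    show "(\<Sum>i\<in>UNIV. w i * inner qi ((conj_transpose R ** ?B ** R) $ i $ i))
        \<le> (\<Sum>i\<in>UNIV. w i * inner qi (?B $ i $ i))" if "two_sided_unitary R" for R
      using max[OF two_sided_unitary_mult[OF V that]]
      by (simp add: F_def conj_transpose_mult matrix_mul_assoc)
  qed (use that skew in \<open>simp_all add: w_def skew_conjugate\<close>)
  then have "?B = diag_mat (\<lambda>a. ?B $ a $ a)"
    by (auto simp: vec_eq_iff diag_mat_nth)
  then show ?thesis
    using that V by blast
qed

text \<open>Imaginary quaternions of equal norm are conjugate: it suffices to solve
  \<open>z * v = norm z *\<^sub>R (v * \<eta>)\<close> with nonzero \<open>v\<close> and
  normalise.\<close>

lemma imaginary_conjugate_unit:
  assumes \<eta>: "\<eta> \<in> {qi, qj, qk}" and z: "qcnj z = - z"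
  obtains u where "norm u = 1" "qcnj u * z * u = norm z *\<^sub>R \<eta>"
proof -
  have z0: "q0 z = 0"
    using z by (simp add: quat_eq_iff)
  have \<eta>2: "\<eta> * \<eta> = - 1"
    using \<eta> quat_unit_relations by auto
  have "(norm z)\<^sup>2 *\<^sub>R 1 = - (z * z)"
    using mult_qcnj[of z] z by (simp add: norm_quat_sq)
  then have z2: "z * z = - ((norm z)\<^sup>2 *\<^sub>R 1)"
    by simp
  \<comment> \<open>Since \<open>z * z\<close> is minus the squared norm,
    \<open>z * \<eta> - norm z *\<^sub>R 1\<close> solves the equation. It vanishes only if
    \<open>z\<close> is \<open>- (norm z *\<^sub>R \<eta>)\<close>, and then a unit anticommuting
    with \<eta> does.\<close>
  have "\<exists>v. v \<noteq> 0 \<and> z * v = norm z *\<^sub>R (v * \<eta>)"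
  proof (cases "z * \<eta> = norm z *\<^sub>R 1")
    case False
    have "z * (z * \<eta> - norm z *\<^sub>R 1) = (z * z) * \<eta> - norm z *\<^sub>R z"
      by (simp add: algebra_simps)
    also have "\<dots> = norm z *\<^sub>R ((z * \<eta> - norm z *\<^sub>R 1) * \<eta>)"
      by (simp add: z2 \<eta>2 algebra_simps power2_eq_square)
    finally show ?thesis
      using False by (intro exI[of _ "z * \<eta> - norm z *\<^sub>R 1"]) simp
  next
    case True
    have "z = - (z * \<eta> * \<eta>)"
      by (simp add: \<eta>2 mult.assoc)
    then have z': "z = - (norm z *\<^sub>R \<eta>)"
      by (simp add: True)
    obtain v where v: "v \<noteq> 0" "\<eta> * v = - (v * \<eta>)"
    proof
      show "(if \<eta> = qi then qj else qi) \<noteq> 0"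
        "\<eta> * (if \<eta> = qi then qj else qi) = - ((if \<eta> = qi then qj else qi) * \<eta>)"
        using \<eta> by (auto simp: quat_eq_iff)
    qed
    then show ?thesis
      by (subst z', intro exI[of _ v]) simp
  qed
  then obtain v where v: "v \<noteq> 0" "z * v = norm z *\<^sub>R (v * \<eta>)"
    by blast
  let ?u = "v /\<^sub>R norm v"
  have "norm ?u = 1"
    using v(1) by simp
  moreover have "qcnj ?u * z * ?u = norm z *\<^sub>R (qcnj ?u * ?u * \<eta>)"
    using v(2) by (simp add: mult.assoc)
  moreover have "qcnj ?u * ?u = 1"
    using \<open>norm ?u = 1\<close> by (simp only: qcnj_mult flip: norm_quat_sq) simp
  ultimately have "qcnj ?u * z * ?u = norm z *\<^sub>R \<eta>"
    by (simp only: mult_1_left)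
  then show ?thesis
    using that \<open>norm ?u = 1\<close> by blast
qed

lemma skew_spectral:
  fixes A A' :: "quat ^ 'n ^ 'n"
  assumes \<eta>: "\<eta> \<in> {qi, qj, qk}" and skew: "conj_transpose A = - A" and inv: "A ** A' = mat 1"
  obtains V l where "two_sided_unitary V" "\<And>a. l a > 0"
    "conj_transpose V ** A ** V = diag_mat (\<lambda>a. l a *\<^sub>R \<eta>)"
proof -
  obtain V d where V: "two_sided_unitary V" and d: "conj_transpose V ** A ** V = diag_mat d"
    using skew_unitarily_diagonal[OF skew] .
  have "qcnj (d a) = - d a" for a
    using arg_cong[OF skew_conjugate[OF skew, of V], of "\<lambda>M. M $ a $ a"]
    by (simp add: d diag_mat_nth)
  then have "\<forall>a. \<exists>u. norm u = 1 \<and> qcnj u * d a * u = norm (d a) *\<^sub>R \<eta>"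
    using imaginary_conjugate_unit[OF \<eta>] by metis
  then obtain u where u: "\<And>a. norm (u a) = 1" "\<And>a. qcnj (u a) * d a * u a = norm (d a) *\<^sub>R \<eta>"
    by metis
  \<comment> \<open>The right inverse of \<open>A\<close>, carried to the new basis, shows that no
    diagonal entry vanishes, so the moduli are strictly positive.\<close>
  have "diag_mat d ** (conj_transpose V ** A' ** V) = mat 1"
    using V inv unfolding two_sided_unitary_def
    by (simp flip: d add: matrix_mul_assoc[symmetric] matrix_mul_cancel)
  then have "d a * (conj_transpose V ** A' ** V) $ a $ a = 1" for a
    by (metis diag_mat_mult_nth diag_mat_nth mat_eq_diag_mat)
  then have "norm (d a) > 0" for a
    by (metis mult_zero_left zero_less_norm_iff zero_neq_one)
  moreover have "conj_transpose (V ** diag_mat u) ** A ** (V ** diag_mat u)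
      = conj_transpose (diag_mat u) ** (conj_transpose V ** A ** V) ** diag_mat u"
    by (simp add: conj_transpose_mult matrix_mul_assoc)
  then have "conj_transpose (V ** diag_mat u) ** A ** (V ** diag_mat u)
      = diag_mat (\<lambda>a. norm (d a) *\<^sub>R \<eta>)"
    by (simp add: d conj_transpose_diag_mat diag_mat_mult u)
  ultimately show ?thesis
    using that[of "V ** diag_mat u" "\<lambda>a. norm (d a)"]
      two_sided_unitary_mult[OF V two_sided_unitary_diag_mat[of u]] u(1) by simp
qed

section \<open>Uniqueness of the moduli\<close>

text \<open>An intertwining unitary \<open>P\<close> is supported on pairs with equal moduli, and its squared entries form
  a doubly stochastic matrix, so the fibres of the two modulus functions have equal sizes.\<close>

lemma diag_intertwining_permutes:
  fixes P :: "quat ^ 'n ^ 'n"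
  assumes P: "two_sided_unitary P" and comm: "diag_mat d ** P = P ** diag_mat d'"
  obtains p where "p permutes (UNIV :: 'n set)" "\<And>a. norm (d' a) = norm (d (p a))"
proof -
  have supp: "norm (d a) = norm (d' b)" if "P $ a $ b \<noteq> 0" for a b
  proof -
    have "norm (d a * P $ a $ b) = norm (P $ a $ b * d' b)"
      using arg_cong[OF comm, of "\<lambda>M. M $ a $ b"] by (simp add: diag_mat_mult_nth mult_diag_mat_nth)
    then show ?thesis
      using that by (simp add: norm_mult)
  qed
  have "card {a. norm (d a) = t} = card {b. norm (d' b) = t}" for t
  proof -
    have "real (card {a. norm (d a) = t})
        = (\<Sum>a\<in>UNIV. of_bool (norm (d a) = t) * (\<Sum>b\<in>UNIV. (norm (P $ a $ b))\<^sup>2))"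
      by (simp add: two_sided_unitary_row[OF P] flip: sum.inter_filter)
    \<comment> \<open>The indicator moves from the row index to the column index because the two
      moduli agree wherever the entry of \<open>P\<close> is nonzero.\<close>
    also have "\<dots> = (\<Sum>a\<in>UNIV. \<Sum>b\<in>UNIV. of_bool (norm (d' b) = t) * (norm (P $ a $ b))\<^sup>2)"
      unfolding sum_distrib_left by (intro sum.cong refl) (use supp in fastforce)
    also have "\<dots> = (\<Sum>b\<in>UNIV. of_bool (norm (d' b) = t) * (\<Sum>a\<in>UNIV. (norm (P $ a $ b))\<^sup>2))"
      unfolding sum_distrib_left by (rule sum.swap)
    also have "\<dots> = real (card {b. norm (d' b) = t})"
      by (simp add: two_sided_unitary_column[OF P] flip: sum.inter_filter)
    finally show ?thesis by simp
  qed
  then have "image_mset (\<lambda>a. norm (d a)) (mset_set UNIV) = image_mset (\<lambda>a. norm (d' a)) (mset_set UNIV)"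
    by (intro multiset_eqI) (simp add: count_image_mset_eq_card_vimage)
  then obtain p where "p permutes (UNIV :: 'n set)" "\<forall>a\<in>UNIV. norm (d' a) = norm (d (p a))"
    using image_mset_eq_implies_permutes[of UNIV "\<lambda>a. norm (d' a)" "\<lambda>a. norm (d a)"] by auto
  then show ?thesis
    using that by blast
qed

section \<open>The decomposition\<close>

text \<open>Clearing the inverse of \<eta> turns orthogonality into invariance of the form with
  matrix \<open>mat \<eta>\<close>, which is skew-Hermitian when \<eta> is an imaginary
  unit.\<close>

lemma quat_orthogonal_iff:
  fixes Q :: "quat ^ 'n ^ 'n"
  assumes "\<eta> \<noteq> 0"
  shows "quat_orthogonal \<eta> Q \<longleftrightarrow> conj_transpose Q ** mat \<eta> ** Q = mat \<eta>"
proof -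
  have "eta_conj_transpose \<eta> Q = mat (inverse \<eta>) ** conj_transpose Q ** mat \<eta>"
    by (simp add: vec_eq_iff eta_conj_transpose_def mat_eq_diag_mat mult_diag_mat_nth diag_mat_mult_nth)
  then have "quat_orthogonal \<eta> Q \<longleftrightarrow>
      mat (inverse \<eta>) ** (conj_transpose Q ** mat \<eta> ** Q) = mat 1"
    by (simp add: quat_orthogonal_def matrix_mul_assoc)
  also have "\<dots> \<longleftrightarrow> conj_transpose Q ** mat \<eta> ** Q = mat \<eta>"
  proof
    assume "mat (inverse \<eta>) ** (conj_transpose Q ** mat \<eta> ** Q) = mat 1"
    then have "mat \<eta> ** (mat (inverse \<eta>) ** (conj_transpose Q ** mat \<eta> ** Q)) = mat \<eta>"
      by simp
    moreover have "mat \<eta> ** mat (inverse \<eta>) = (mat 1 :: quat ^ 'n ^ 'n)"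
      using assms by (simp add: mat_eq_diag_mat diag_mat_mult)
    ultimately show "conj_transpose Q ** mat \<eta> ** Q = mat \<eta>"
      by (simp add: matrix_mul_cancel)
  qed (use assms in \<open>simp add: mat_eq_diag_mat diag_mat_mult\<close>)
  finally show ?thesis .
qed

text \<open>The inverse of \<open>Q\<close> is \<open>Q' = G' ** U ** S\<close>, and it preserves
  the form of \<eta> exactly when \<open>Q\<close> does. As \<open>G' ** U = Q' ** S'\<close>,
  congruence by the real diagonal \<open>S'\<close> gives the stated condition. Existence uses it
  from right to left, uniqueness from left to right.\<close>

lemma quat_orthogonal_factor_iff:
  fixes G G' U Q :: "quat ^ 'n ^ 'n"
  assumes "\<eta> \<noteq> 0" and G': "G ** G' = mat 1" "G' ** G = mat 1" and U: "two_sided_unitary U"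
    and s: "\<And>a. s a > 0" and G: "G = U ** diag_mat (\<lambda>a. of_real (s a)) ** Q"
  shows "quat_orthogonal \<eta> Q \<longleftrightarrow>
    conj_transpose U ** (conj_transpose G' ** mat \<eta> ** G') ** U = diag_mat (\<lambda>a. (1 / (s a)\<^sup>2) *\<^sub>R \<eta>)"
proof -
  define S where "S = diag_mat (\<lambda>a. of_real (s a) :: quat)"
  define S' where "S' = diag_mat (\<lambda>a. of_real (inverse (s a)) :: quat)"
  define Q' where "Q' = G' ** U ** S"
  have SS': "S ** S' = mat 1" "S' ** S = mat 1"
    using s by (auto simp: S_def S'_def diag_mat_mult mat_eq_diag_mat less_imp_neq[symmetric]
        simp flip: of_real_mult)
  have S'_D: "conj_transpose S' = S'"
    by (simp add: S'_def conj_transpose_diag_mat del: of_real_inverse)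
  have UU: "conj_transpose U ** U = mat 1" "U ** conj_transpose U = mat 1"
    using U by (simp_all add: two_sided_unitary_def)
  have "Q' ** Q = mat 1"
    using G' by (simp add: Q'_def G S_def[symmetric] matrix_mul_assoc)
  moreover have "Q = S' ** conj_transpose U ** G"
    unfolding G S_def[symmetric] by (simp add: matrix_mul_assoc[symmetric] matrix_mul_cancel UU SS')
  then have "Q ** Q' = mat 1"
    unfolding Q'_def by (simp add: matrix_mul_assoc[symmetric] matrix_mul_cancel UU SS' G')
  ultimately have Q': "Q' ** Q = mat 1" "Q ** Q' = mat 1" .
  then have Q'_D: "conj_transpose Q' ** conj_transpose Q = mat 1" "conj_transpose Q ** conj_transpose Q' = mat 1"
    by (simp_all flip: conj_transpose_mult)
  let ?E = "conj_transpose Q' ** (mat \<eta> ** Q')"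
  have "quat_orthogonal \<eta> Q \<longleftrightarrow> ?E = mat \<eta>"
    unfolding quat_orthogonal_iff[OF \<open>\<eta> \<noteq> 0\<close>]
  proof
    assume "conj_transpose Q ** mat \<eta> ** Q = mat \<eta>"
    then have "?E = conj_transpose Q' ** (conj_transpose Q ** mat \<eta> ** Q ** Q')"
      by simp
    then show "?E = mat \<eta>"
      by (simp add: matrix_mul_assoc[symmetric] matrix_mul_cancel Q' Q'_D)
  next
    assume "?E = mat \<eta>"
    then have "conj_transpose Q ** mat \<eta> ** Q = conj_transpose Q ** (?E ** Q)"
      by (simp add: matrix_mul_assoc[symmetric])
    then show "conj_transpose Q ** mat \<eta> ** Q = mat \<eta>"
      by (simp add: matrix_mul_assoc[symmetric] matrix_mul_cancel Q' Q'_D)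
  qed
  moreover have "?E = mat \<eta> \<longleftrightarrow> S' ** (?E ** S') = S' ** (mat \<eta> ** S')"
  proof
    assume "S' ** (?E ** S') = S' ** (mat \<eta> ** S')"
    then have "S ** (S' ** (?E ** S')) ** S = S ** (S' ** (mat \<eta> ** S')) ** S"
      by simp
    then show "?E = mat \<eta>"
      by (simp add: matrix_mul_assoc[symmetric] matrix_mul_cancel SS')
  qed simp
  moreover have "conj_transpose U ** (conj_transpose G' ** mat \<eta> ** G') ** U = S' ** (?E ** S')"
  proof -
    have "G' ** U = Q' ** S'"
      by (simp add: Q'_def matrix_mul_assoc[symmetric] SS')
    then have "conj_transpose U ** conj_transpose G' = S' ** conj_transpose Q'"
      by (simp flip: conj_transpose_mult) (simp add: conj_transpose_mult S'_D)
    moreover have "conj_transpose U ** (conj_transpose G' ** mat \<eta> ** G') ** U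
        = (conj_transpose U ** conj_transpose G') ** mat \<eta> ** (G' ** U)"
      by (simp add: matrix_mul_assoc)
    ultimately show ?thesis
      unfolding \<open>G' ** U = Q' ** S'\<close> by (simp only: matrix_mul_assoc)
  qed
  moreover have "S' ** (mat \<eta> ** S') = diag_mat (\<lambda>a. (1 / (s a)\<^sup>2) *\<^sub>R \<eta>)"
    by (simp add: S'_def mat_eq_diag_mat diag_mat_mult of_real_def power2_eq_square divide_inverse)
  ultimately show ?thesis
    by (simp only:)
qed

lemma positive_diagonal_iff:
  "positive_diagonal S \<longleftrightarrow> (\<exists>s. (\<forall>a. s a > 0) \<and> S = diag_mat (\<lambda>a. of_real (s a)))"
proof
  assume S: "positive_diagonal S"
  then have "\<forall>a. \<exists>r>0. S $ a $ a = of_real r"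
    by (simp add: positive_diagonal_def)
  from choice[OF this] obtain s where s: "\<And>a. s a > 0" "\<And>a. S $ a $ a = of_real (s a)"
    by blast
  have "S $ a $ b = diag_mat (\<lambda>a. of_real (s a)) $ a $ b" for a b
    using S s(2)[of a] by (cases "a = b") (simp_all add: positive_diagonal_def diag_mat_nth)
  then have "S = diag_mat (\<lambda>a. of_real (s a))"
    by (simp add: vec_eq_iff)
  then show "\<exists>s. (\<forall>a. s a > 0) \<and> S = diag_mat (\<lambda>a. of_real (s a))"
    using s(1) by blast
next
  assume "\<exists>s. (\<forall>a. s a > 0) \<and> S = diag_mat (\<lambda>a. of_real (s a))"
  then obtain s where "\<And>a. s a > 0" "S = diag_mat (\<lambda>a. of_real (s a))"
    by blast
  then show "positive_diagonal S"
    by (simp add: positive_diagonal_def diag_mat_nth)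
qed

theorem theorem5p17:
  fixes \<eta> :: quat and G :: "quat ^ 'n ^ 'n"
  assumes "\<eta> \<in> {qi, qj, qk}" and "invertible G"
  shows "\<exists>U \<Sigma> Q. quat_unitary U \<and> positive_diagonal \<Sigma> \<and> quat_orthogonal \<eta> Q \<and>
      G = U ** \<Sigma> ** Q \<and>
      (\<forall>U' \<Sigma>' Q'. quat_unitary U' \<and> positive_diagonal \<Sigma>' \<and> quat_orthogonal \<eta> Q' \<and>
          G = U' ** \<Sigma>' ** Q' \<longrightarrow>
        (\<exists>p. p permutes (UNIV :: 'n set) \<and> (\<forall>a. \<Sigma>' $ a $ a = \<Sigma> $ p a $ p a)))"
proof -
  have \<eta>: "\<eta> \<noteq> 0" "qcnj \<eta> = - \<eta>"
    using assms(1) by (auto simp: quat_eq_iff)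
  obtain G' where G': "G ** G' = mat 1" "G' ** G = mat 1"
    using assms(2) by (auto simp: invertible_def)
  define A where "A = conj_transpose G' ** mat \<eta> ** G'"
  have skew: "conj_transpose A = - A"
    unfolding A_def by (rule skew_conjugate)
      (auto simp: vec_eq_iff conj_transpose_def mat_def \<eta>)
  have "conj_transpose G' ** conj_transpose G = mat 1"
    using G' by (simp flip: conj_transpose_mult)
  moreover have "mat \<eta> ** mat (inverse \<eta>) = (mat 1 :: quat ^ 'n ^ 'n)"
    using \<eta> by (simp add: mat_eq_diag_mat diag_mat_mult)
  ultimately have "A ** (G ** mat (inverse \<eta>) ** conj_transpose G) = mat 1"
    unfolding A_def using G' by (simp add: matrix_mul_assoc[symmetric] matrix_mul_cancel)
  then obtain V l where V: "two_sided_unitary V" and l: "\<And>a. l a > 0"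
    and AV: "conj_transpose V ** A ** V = diag_mat (\<lambda>a. l a *\<^sub>R \<eta>)"
    using skew_spectral[OF assms(1) skew] by blast
  \<comment> \<open>Chosen so that \<open>1 / (s a)\<^sup>2 = l a\<close>, the diagonal demanded by
    \<open>quat_orthogonal_factor_iff\<close>.\<close>
  define s where "s a = 1 / sqrt (l a)" for a
  have s: "s a > 0" "1 / (s a)\<^sup>2 = l a" for a
    using l[of a] by (simp_all add: s_def power_divide)
  define \<Sigma> where "\<Sigma> = diag_mat (\<lambda>a. of_real (s a) :: quat)"
  define Q where "Q = diag_mat (\<lambda>a. of_real (inverse (s a))) ** conj_transpose V ** G"
  have "\<Sigma> ** diag_mat (\<lambda>a. of_real (inverse (s a))) = mat 1"
    using s by (auto simp: \<Sigma>_def diag_mat_mult mat_eq_diag_mat less_imp_neq[symmetric]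
        simp flip: of_real_mult)
  then have GQ: "G = V ** \<Sigma> ** Q"
    using V by (simp add: Q_def two_sided_unitary_def matrix_mul_assoc[symmetric] matrix_mul_cancel)
  moreover have "quat_orthogonal \<eta> Q"
    using quat_orthogonal_factor_iff[OF \<eta>(1) G' V, of s Q] s GQ AV by (simp add: A_def \<Sigma>_def)
  moreover have "quat_unitary V"
    using V by (simp add: quat_unitary_def two_sided_unitary_def)
  moreover have "positive_diagonal \<Sigma>"
    using s by (auto simp: positive_diagonal_iff \<Sigma>_def)
  moreover have "\<exists>p. p permutes (UNIV :: 'n set) \<and> (\<forall>a. \<Sigma>' $ a $ a = \<Sigma> $ p a $ p a)"
    if U': "quat_unitary U'" and "positive_diagonal \<Sigma>'" and Q': "quat_orthogonal \<eta> Q'"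
      and G_eq: "G = U' ** \<Sigma>' ** Q'" for U' \<Sigma>' Q'
  proof -
    obtain s' where s': "\<And>a. s' a > 0" "\<Sigma>' = diag_mat (\<lambda>a. of_real (s' a))"
      using \<open>positive_diagonal \<Sigma>'\<close> by (auto simp: positive_diagonal_iff)
    \<comment> \<open>Invertibility of \<open>G\<close> supplies a right inverse of
      \<open>U'\<close>; it must coincide with the left inverse \<open>conj_transpose U'\<close>, so
      \<open>U'\<close> is unitary on both sides.\<close>
    have "U' ** (\<Sigma>' ** Q' ** G') = mat 1"
      using G' G_eq by (simp add: matrix_mul_assoc)
    moreover from this have "conj_transpose U' = \<Sigma>' ** Q' ** G'"
      using U' matrix_mul_cancel[of "conj_transpose U'" U' "\<Sigma>' ** Q' ** G'"]
      by (simp add: quat_unitary_def)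
    ultimately have W: "two_sided_unitary U'"
      using U' by (simp add: quat_unitary_def two_sided_unitary_def)
    have AU': "conj_transpose U' ** A ** U' = diag_mat (\<lambda>a. (1 / (s' a)\<^sup>2) *\<^sub>R \<eta>)"
      using quat_orthogonal_factor_iff[OF \<eta>(1) G' W, of s' Q'] s' Q' G_eq by (simp add: A_def)
    let ?P = "conj_transpose V ** U'"
    have P: "two_sided_unitary ?P"
      by (intro two_sided_unitary_mult two_sided_unitary_conj_transpose V W)
    \<comment> \<open>Both diagonal matrices are unitary conjugates of the same \<open>A\<close>,
      hence intertwined by the change of basis.\<close>
    have "diag_mat (\<lambda>a. l a *\<^sub>R \<eta>) ** ?P = ?P ** diag_mat (\<lambda>a. (1 / (s' a)\<^sup>2) *\<^sub>R \<eta>)"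
      unfolding AV[symmetric] AU'[symmetric] using V W
      by (simp add: two_sided_unitary_def matrix_mul_assoc[symmetric] matrix_mul_cancel)
    then obtain p where p: "p permutes (UNIV :: 'n set)"
      "\<And>a. norm ((1 / (s' a)\<^sup>2) *\<^sub>R \<eta>) = norm (l (p a) *\<^sub>R \<eta>)"
      using diag_intertwining_permutes[OF P] by blast
    have "s' a = s (p a)" for a
    proof -
      \<comment> \<open>The scalars are positive, so the norms determine them once the nonzero norm
        of \<eta> is cancelled.\<close>
      have "(1 / (s' a)\<^sup>2) * norm \<eta> = l (p a) * norm \<eta>"
        using p(2)[of a] l[of "p a"] by simp
      then have "1 / (s' a)\<^sup>2 = 1 / (s (p a))\<^sup>2"
        using \<eta>(1) by (simp only: mult_right_cancel norm_eq_zero s(2) not_False_eq_True)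
      then have "(s' a)\<^sup>2 = (s (p a))\<^sup>2"
        by simp
      then show ?thesis
        using s'(1)[of a] s(1)[of "p a"] by (simp add: power2_eq_iff_nonneg)
    qed
    then show ?thesis
      using p(1) by (intro exI[of _ p]) (simp add: \<Sigma>_def s'(2) diag_mat_nth)
  qed
  ultimately show ?thesis
    by blast
qed

end
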